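(* Let $X$ be a Banach space and let $p \in \mathcal{M}_d$. Then $(PAA_d(\mathbb{Z},X,p), \Vert \cdot \Vert_{\infty})$ is a Banach space.
   Context: $\ell^{\infty}(\mathbb{Z},X)$ denotes the Banach space of all bounded two-sided sequences $u = (u_n)_{n \in \mathbb{Z}}$ with values in $X$, with norm $\Vert u \Vert_{\infty} = \sup_{n \in \mathbb{Z}} \Vert u_n \Vert$. $\mathcal{M}_d$ denotes the set of all two-sided real sequences $p = (p_n)_{n \in \mathbb{Z}}$ satisfying $p_n \geq 0$ for all $n \in \mathbb{Z}$ and $\sum_{n \in \mathbb{Z}} p_n = +\infty$. A sequence $u = (u_n)_{n \in \mathbb{Z}} \in X^{\mathbb{Z}}$ is almost automorphic if for every sequence of integers $(k_n')_{n \in \mathbb{N}}$ there exists a subsequence $(k_n)_n$ of $(k_n')_n$ such that $v_q = \lim_{n \to \infty} u_{q+k_n}$ exists for all $q \in \mathbb{Z}$ and $\lim_{n \to \infty} v_{q-k_n} = u_q$ for all $q \in \mathbb{Z}$ (limits in the norm of $X$). $AA_d(\mathbb{Z},X)$ denotes the space of all such sequences (which are bounded). For $p \in \mathcal{M}_d$, a sequence $u \in \ell^{\infty}(\mathbb{Z},X)$ is weighted ergodic if $\lim_{N \to +\infty} \frac{1}{\sum_{n=-N}^{N} p_n} \sum_{n=-N}^{N} \Vert u_n \Vert p_n = 0$. $\mathcal{E}_d(\mathbb{Z},X,p)$ denotes the space of all such sequences. A sequence $u \in \ell^{\infty}(\mathbb{Z},X)$ is weighted pseudo almost automorphic if $u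 = v+w$ with $v \in AA_d(\mathbb{Z},X)$ and $w \in \mathcal{E}_d(\mathbb{Z},X,p)$. $PAA_d(\mathbb{Z},X,p)$ denotes the space of all such sequences. *)

theory Defs
  imports "HOL-Analysis.Analysis"
begin

text \<open>
  The integers carry the discrete topology, so every function on them is continuous and
  the library type of bounded continuous functions \<^typ>\<open>int \<Rightarrow>\<^sub>C 'a\<close>, with its
  pointwise operations and supremum norm, is the space of bounded two-sided sequences.
\<close>

type_synonym 'a linf = "int \<Rightarrow>\<^sub>C 'a"

lemma bounded_sequence_in_linf:
  fixes u :: "int \<Rightarrow> 'a::metric_space"
  shows "(\<exists>u'::'a linf. apply_bcontfun u' = u) \<longleftrightarrow> bounded (range u)"
proof
  assume "bounded (range u)"
  moreover have "continuous_on UNIV u"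
    by (simp add: continuous_on_open_vimage open_discrete)
  ultimately have "u \<in> bcontfun"
    by (simp add: bcontfun_def)
  then show "\<exists>u'::'a linf. apply_bcontfun u' = u"
    by (metis bcontfunE)
qed auto

lemma norm_linf:
  fixes u :: "'a::real_normed_vector linf"
  shows "norm u = (SUP n. norm (apply_bcontfun u n))"
  by (simp add: norm_bcontfun_def dist_bcontfun.rep_eq)

definition M_d :: "(int \<Rightarrow> real) set" where
  "M_d = {p. (\<forall>n. 0 \<le> p n) \<and> (\<Sum>\<^sub>\<infinity>n. ennreal (p n)) = \<infinity>}"

definition almost_automorphic :: "(int \<Rightarrow> 'a::real_normed_vector) \<Rightarrow> bool" where
  "almost_automorphic u \<longleftrightarrow>
    (\<forall>k' :: nat \<Rightarrow> int. \<exists>r :: nat \<Rightarrow> nat. strict_mono r \<and>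
      (let k = k' \<circ> r in
        \<exists>v. (\<forall>q. (\<lambda>n. u (q + k n)) \<longlonglongrightarrow> v q) \<and>
            (\<forall>q. (\<lambda>n. v (q - k n)) \<longlonglongrightarrow> u q)))"

text \<open>
  Boundedness is not an extra requirement on almost automorphic sequences, so nothing is
  lost by defining \<open>AA_d\<close> below as a subset of \<^typ>\<open>'a linf\<close>.
\<close>

lemma almost_automorphic_imp_bounded:
  assumes "almost_automorphic u"
  shows "bounded (range u)"
proof (rule ccontr)
  assume "\<not> bounded (range u)"
  then have "\<forall>n::nat. \<exists>k. norm (u k) > real n"
    by (metis bounded_iff linorder_not_le rangeE)
  then obtain k' where k': "\<And>n::nat. norm (u (k' n)) > real n"
    by metis
  obtain r :: "nat \<Rightarrow> nat" and v where r: "strict_mono r"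
    and v: "\<And>q. (\<lambda>n. u (q + k' (r n))) \<longlonglongrightarrow> v q"
    using assms unfolding almost_automorphic_def Let_def comp_def by metis
  have "Bseq (\<lambda>n. u (k' (r n)))"
    using v[of 0] by (simp add: convergent_imp_Bseq convergentI)
  then obtain K where K: "\<And>n. norm (u (k' (r n))) \<le> K"
    unfolding Bseq_def by blast
  obtain n :: nat where "K < real n"
    using reals_Archimedean2 by blast
  also have "real n \<le> real (r n)"
    using seq_suble[OF r] by simp
  also have "\<dots> < norm (u (k' (r n)))"
    by (rule k')
  finally show False
    using K[of n] by simp
qed

definition AA_d :: "'a::real_normed_vector linf set" where
  "AA_d = {u. almost_automorphic (apply_bcontfun u)}"

definition E_d :: "(int \<Rightarrow> real) \<Rightarrow> 'a::real_normed_vector linf set" where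
  "E_d p = {u. (\<lambda>N::nat. 1 / (\<Sum>n=-int N..int N. p n) * (\<Sum>n=-int N..int N. norm (apply_bcontfun u n) * p n))
                 \<longlonglongrightarrow> 0}"

definition PAA_d :: "(int \<Rightarrow> real) \<Rightarrow> 'a::real_normed_vector linf set" where
  "PAA_d p = {u. \<exists>v\<in>AA_d. \<exists>w\<in>E_d p. u = v + w}"

end

theory Submission
  imports Defs "HOL-Library.Diagonal_Subsequence"
begin

text \<open>
  Both \<^term>\<open>AA_d\<close> and \<^term>\<open>E_d p\<close> are closed subspaces of \<^typ>\<open>'a linf\<close>; the point is that
  their sum is closed, although for a weight that is not translation invariant the decomposition
  need not be unique. If \<open>u = v + w\<close> and \<open>c\<close> is the norm of \<open>u\<close>, let \<open>v'\<close> be the pointwise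
  radial truncation of \<open>v\<close> to the ball of radius \<open>c\<close>. Continuous images of almost automorphic
  sequences are almost automorphic, and the norm of \<open>v n\<close> is at most \<open>c\<close> plus the norm of \<open>w n\<close>,
  so \<open>v - v'\<close> is dominated pointwise by \<open>w\<close> and hence ergodic. Thus every \<open>u\<close> in the sum has a
  decomposition whose almost automorphic part is no larger than \<open>u\<close>, and a rapidly convergent
  series of such parts shows that the sum is closed.
\<close>

section \<open>Sums of closed subspaces\<close>

text \<open>A sum of two closed subspaces need not be closed. The norm bound in \<open>dec\<close>
  rescues it: the increments of a fast Cauchy sequence in the sum have \<open>A\<close>-parts that
  form an absolutely convergent series.\<close>

lemma closed_sum_subspaces:
  fixes A E :: "'a::banach set"
  assumes A: "subspace A" "closed A" and E: "subspace E" "closed E"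
    and dec: "\<And>a e. a \<in> A \<Longrightarrow> e \<in> E \<Longrightarrow> \<exists>a'\<in>A. a + e - a' \<in> E \<and> norm a' \<le> norm (a + e)"
  shows "closed {a + e |a e. a \<in> A \<and> e \<in> E}"
proof -
  define S where "S = {a + e |a e. a \<in> A \<and> e \<in> E}"
  have subspace_S: "subspace S"
    using subspace_sums[OF A(1) E(1)] by (simp add: S_def)
  have "l \<in> S" if xl: "(\<forall>n. x n \<in> S) \<and> x \<longlonglongrightarrow> l" for x l
  proof -
    have "\<exists>y. y \<in> S \<and> norm (y - l) < (1/2) ^ n" for n :: nat
    proof -
      have "\<exists>N. \<forall>m\<ge>N. norm (x m - l) < (1/2) ^ n"
        using xl by (intro LIMSEQ_D) auto
      then show ?thesis using xl by blast
    qed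
    then obtain f where f: "\<And>n. f n \<in> S" "\<And>n::nat. norm (f n - l) < (1/2) ^ n"
      by metis
    have "\<exists>a\<in>A. f (Suc n) - f n - a \<in> E \<and> norm a \<le> norm (f (Suc n) - f n)" for n
    proof -
      have "f (Suc n) - f n \<in> S"
        by (intro subspace_diff subspace_S f(1))
      then show ?thesis using dec by (auto simp: S_def)
    qed
    then obtain a where a: "\<And>n. a n \<in> A" "\<And>n. f (Suc n) - f n - a n \<in> E"
      "\<And>n. norm (a n) \<le> norm (f (Suc n) - f n)"
      by metis
    have "norm (a n) \<le> 2 * (1/2) ^ n" for n
    proof -
      have "norm (a n) \<le> norm ((f (Suc n) - l) - (f n - l))"
        using a(3)[of n] by simp
      also have "\<dots> \<le> norm (f (Suc n) - l) + norm (f n - l)"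
        by (rule norm_triangle_ineq4)
      also have "\<dots> \<le> (1/2) ^ Suc n + (1/2) ^ n"
        using f(2) by (intro add_mono less_imp_le)
      also have "\<dots> \<le> 2 * (1/2) ^ n"
        by simp
      finally show ?thesis .
    qed
    then have "summable a"
      by (intro summable_comparison_test'[where N=0, OF summable_mult[OF summable_geometric]]) auto
    then have lim_a: "(\<lambda>n. \<Sum>i<n. a i) \<longlonglongrightarrow> suminf a"
      by (rule summable_LIMSEQ)
    have sum_A: "suminf a \<in> A"
      by (rule closed_sequentially[OF A(2) _ lim_a]) (simp add: subspace_sum[OF A(1)] a(1))
    \<comment> \<open>Any splitting of \<open>f 0\<close> will do: norm bounds are needed only for
      the increments, whose \<open>A\<close>-parts are summed.\<close>
    obtain a0 e0 where a0: "f 0 = a0 + e0" "a0 \<in> A" "e0 \<in> E"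
      using f(1)[of 0] by (auto simp: S_def)
    have rest: "f n - a0 - (\<Sum>i<n. a i) \<in> E" for n
    proof -
      have "f n - a0 - (\<Sum>i<n. a i) = e0 + (\<Sum>i<n. f (Suc i) - f i - a i)"
        by (induction n) (auto simp: a0 algebra_simps)
      also have "\<dots> \<in> E"
        by (intro subspace_add[OF E(1)] subspace_sum[OF E(1)] a0 a(2))
      finally show ?thesis .
    qed
    have "f \<longlonglongrightarrow> l"
      by (rule LIM_zero_cancel, rule Lim_null_comparison[OF _ LIMSEQ_power_zero[of "1/2::real"]])
         (auto intro!: always_eventually less_imp_le f(2))
    then have "(\<lambda>n. f n - a0 - (\<Sum>i<n. a i)) \<longlonglongrightarrow> l - a0 - suminf a"
      by (intro tendsto_diff tendsto_const lim_a)
    then have "l - a0 - suminf a \<in> E"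
      by (rule closed_sequentially[OF E(2) rest])
    moreover have "l = (a0 + suminf a) + (l - a0 - suminf a)"
      by simp
    ultimately show ?thesis
      using subspace_add[OF A(1) a0(2) sum_A] unfolding S_def by blast
  qed
  then have "closed S"
    unfolding closed_sequential_limits by blast
  then show ?thesis
    by (simp add: S_def)
qed

text \<open>
  The library proves completeness for metric domains only, and \<^typ>\<open>int\<close> is not an instance of
  \<^class>\<open>metric_space\<close>.
\<close>

instance bcontfun :: (topological_space, complete_space) complete_space
proof
  fix f :: "nat \<Rightarrow> 'a \<Rightarrow>\<^sub>C 'b"
  assume f: "Cauchy f"
  have "uniformly_Cauchy_on UNIV (\<lambda>n. apply_bcontfun (f n))"
    unfolding uniformly_Cauchy_on_def
    using f by (metis Cauchy_def dist_fun_lt_imp_dist_val_lt)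
  then obtain g where "uniform_limit UNIV f g sequentially"
    using Cauchy_uniformly_convergent uniformly_convergent_on_def by blast
  then show "convergent f"
    by (metis uniform_limit_bcontfunE sequentially_bot convergentI)
qed

instance bcontfun :: (topological_space, banach) banach ..

section \<open>Almost automorphic sequences\<close>

text \<open>Bochner's condition along one fixed sequence, without extraction. Closure properties are
  shown for a fixed \<open>k\<close> first and subsequences chosen afterwards.\<close>

definition returns_along :: "(nat \<Rightarrow> int) \<Rightarrow> (int \<Rightarrow> 'a::real_normed_vector) \<Rightarrow> bool" where
  "returns_along k u \<longleftrightarrow>
    (\<exists>v. (\<forall>q. (\<lambda>n. u (q + k n)) \<longlonglongrightarrow> v q) \<and> (\<forall>q. (\<lambda>n. v (q - k n)) \<longlonglongrightarrow> u q))"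

lemma almost_automorphic_returns_along:
  "almost_automorphic u \<longleftrightarrow> (\<forall>k :: nat \<Rightarrow> int. \<exists>r. strict_mono r \<and> returns_along (k \<circ> r) u)"
  by (simp add: almost_automorphic_def returns_along_def Let_def)

lemma returns_along_subseq:
  assumes "returns_along k u" "strict_mono r"
  shows "returns_along (k \<circ> r) u"
proof -
  obtain v where v: "\<And>q. (\<lambda>n. u (q + k n)) \<longlonglongrightarrow> v q" "\<And>q. (\<lambda>n. v (q - k n)) \<longlonglongrightarrow> u q"
    using assms(1) by (auto simp: returns_along_def)
  have "(\<lambda>n. u (q + (k \<circ> r) n)) \<longlonglongrightarrow> v q" "(\<lambda>n. v (q - (k \<circ> r) n)) \<longlonglongrightarrow> u q" for q
    using LIMSEQ_subseq_LIMSEQ[OF v(1) assms(2)] LIMSEQ_subseq_LIMSEQ[OF v(2) assms(2)]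
    by (simp_all add: comp_def)
  then show ?thesis
    by (auto simp: returns_along_def)
qed

text \<open>For the diagonal argument: the diagonal sequence refines the \<open>m\<close>-th
  extraction only after finitely many terms.\<close>

lemma returns_along_offset:
  assumes "returns_along (k \<circ> (+) m) u"
  shows "returns_along k u"
proof -
  obtain v where v: "\<And>q. (\<lambda>n. u (q + k (n + m))) \<longlonglongrightarrow> v q"
    "\<And>q. (\<lambda>n. v (q - k (n + m))) \<longlonglongrightarrow> u q"
    using assms by (auto simp: returns_along_def add.commute)
  then show ?thesis
    unfolding returns_along_def by (blast intro: LIMSEQ_offset)
qed

lemma returns_along_add:
  assumes "returns_along k u" "returns_along k w"
  shows "returns_along k (\<lambda>n. u n + w n)"
proof -
  obtain v v' where
    "\<And>q. (\<lambda>n. u (q + k n)) \<longlonglongrightarrow> v q" "\<And>q. (\<lambda>n. v (q - k n)) \<longlonglongrightarrow> u q"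
    "\<And>q. (\<lambda>n. w (q + k n)) \<longlonglongrightarrow> v' q" "\<And>q. (\<lambda>n. v' (q - k n)) \<longlonglongrightarrow> w q"
    using assms by (auto simp: returns_along_def)
  then show ?thesis
    unfolding returns_along_def by (intro exI[of _ "\<lambda>q. v q + v' q"]) (auto intro!: tendsto_add)
qed

text \<open>An interchange of limits, once in each direction. The limits \<open>g m\<close> inherit
  the uniform Cauchy estimate of \<open>f\<close>, which yields the candidate
  \<open>v\<close>.\<close>

lemma returns_along_uniform_limit:
  fixes u :: "int \<Rightarrow> 'a::banach"
  assumes f: "uniform_limit UNIV f u sequentially"
    and k: "\<And>m::nat. returns_along k (f m)"
  shows "returns_along k u"
proof -
  obtain g where g: "\<And>m q. (\<lambda>n. f m (q + k n)) \<longlonglongrightarrow> g m q"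
    "\<And>m q. (\<lambda>n. g m (q - k n)) \<longlonglongrightarrow> f m q"
    using k unfolding returns_along_def by metis
  have "uniformly_Cauchy_on UNIV f"
    using f by (intro uniformly_convergent_Cauchy) (auto simp: uniformly_convergent_on_def)
  have "uniformly_Cauchy_on UNIV g"
    unfolding uniformly_Cauchy_on_def
  proof (intro allI impI)
    fix e :: real assume "e > 0"
    \<comment> \<open>Strict inequalities weaken to \<open>\<le>\<close> in the limit along
      \<open>k\<close>, hence the margin \<open>e / 2\<close>.\<close>
    then obtain M where M: "\<And>q m n. m \<ge> M \<Longrightarrow> n \<ge> M \<Longrightarrow> dist (f m q) (f n q) < e / 2"
      using \<open>uniformly_Cauchy_on UNIV f\<close> unfolding uniformly_Cauchy_on_def
      by (metis UNIV_I half_gt_zero)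
    have "dist (g m q) (g n q) < e" if "m \<ge> M" "n \<ge> M" for m n q
    proof -
      have "dist (g m q) (g n q) \<le> e / 2"
        using tendsto_dist[OF g(1)[of m q] g(1)[of n q]] M[OF that]
        by (intro tendsto_upperbound) (auto intro!: always_eventually less_imp_le)
      then show ?thesis using \<open>e > 0\<close> by simp
    qed
    then show "\<exists>M. \<forall>x\<in>UNIV. \<forall>m\<ge>M. \<forall>n\<ge>M. dist (g m x) (g n x) < e"
      by blast
  qed
  then obtain v where v: "uniform_limit UNIV g v sequentially"
    using Cauchy_uniformly_convergent uniformly_convergent_on_def by blast
  \<comment> \<open>Uniformity on all integers survives sampling along any \<open>c\<close>;
    swapping the limits needs this uniformity in \<open>n\<close>.\<close>
  have shift: "uniform_limit UNIV (\<lambda>m n. h m (c n)) (\<lambda>n. h' (c n)) sequentially"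
    if "uniform_limit UNIV h h' sequentially"
    for h and h' :: "int \<Rightarrow> 'a" and c :: "nat \<Rightarrow> int"
    using that by (rule uniform_limit_compose') auto
  have "(\<lambda>n. u (q + k n)) \<longlonglongrightarrow> v q" for q
    by (rule swap_uniform_limit'[OF _ _ shift[OF f]])
       (auto intro!: always_eventually g(1) tendsto_uniform_limitI[OF v])
  moreover have "(\<lambda>n. v (q - k n)) \<longlonglongrightarrow> u q" for q
    by (rule swap_uniform_limit'[OF _ _ shift[OF v]])
       (auto intro!: always_eventually g(2) tendsto_uniform_limitI[OF f])
  ultimately show ?thesis
    by (auto simp: returns_along_def)
qed

text \<open>The same subsequence works, with \<open>T\<close> applied to the limit sequence too.
  Used for scalar multiples and radial truncation.\<close>

lemma almost_automorphic_compose: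
  assumes "almost_automorphic u" and T: "continuous_on UNIV T"
  shows "almost_automorphic (\<lambda>n. T (u n))"
proof -
  have "returns_along k (\<lambda>n. T (u n))" if k: "returns_along k u" for k
  proof -
    obtain v where v: "\<And>q. (\<lambda>n. u (q + k n)) \<longlonglongrightarrow> v q" "\<And>q. (\<lambda>n. v (q - k n)) \<longlonglongrightarrow> u q"
      using k by (auto simp: returns_along_def)
    have "(\<lambda>n. T (u (q + k n))) \<longlonglongrightarrow> T (v q)" "(\<lambda>n. T (v (q - k n))) \<longlonglongrightarrow> T (u q)" for q
      using continuous_on_tendsto_compose[OF T v(1)] continuous_on_tendsto_compose[OF T v(2)]
      by auto
    then show ?thesis
      unfolding returns_along_def by (intro exI[of _ "\<lambda>q. T (v q)"]) auto
  qed
  then show ?thesis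
    using assms(1) unfolding almost_automorphic_returns_along by blast
qed

lemma almost_automorphic_add:
  assumes u: "almost_automorphic u" and w: "almost_automorphic w"
  shows "almost_automorphic (\<lambda>n. u n + w n)"
  unfolding almost_automorphic_returns_along
proof
  fix k :: "nat \<Rightarrow> int"
  obtain r where r: "strict_mono r" "returns_along (k \<circ> r) u"
    using u unfolding almost_automorphic_returns_along by blast
  \<comment> \<open>\<open>w\<close> is tested on the sequence already extracted for
    \<open>u\<close>, so one subsequence serves both.\<close>
  obtain s where s: "strict_mono s" "returns_along (k \<circ> r \<circ> s) w"
    using w unfolding almost_automorphic_returns_along by blast
  show "\<exists>r. strict_mono r \<and> returns_along (k \<circ> r) (\<lambda>n. u n + w n)"
    using returns_along_add[OF returns_along_subseq[OF r(2) s(1)] s(2)] strict_mono_o[OF r(1) s(1)]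
    by (auto simp: comp_assoc)
qed

lemma almost_automorphic_uniform_limit:
  fixes u :: "int \<Rightarrow> 'a::banach"
  assumes f: "uniform_limit UNIV f u sequentially"
    and aa: "\<And>m::nat. almost_automorphic (f m)"
  shows "almost_automorphic u"
  unfolding almost_automorphic_returns_along
proof
  fix k :: "nat \<Rightarrow> int"
  \<comment> \<open>One extraction for each \<open>f m\<close>; the diagonal sequence then serves
    all \<open>m\<close> at once.\<close>
  interpret subseqs "\<lambda>m r. returns_along (k \<circ> r) (f m)"
    using aa unfolding almost_automorphic_returns_along
    by unfold_locales (metis comp_assoc)
  have "returns_along (k \<circ> diagseq) (f m)" for m
    using diagseq_holds[of m]
    by (metis comp_assoc returns_along_subseq returns_along_offset)
  then show "\<exists>r. strict_mono r \<and> returns_along (k \<circ> r) u"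
    using returns_along_uniform_limit[OF f] subseq_diagseq by blast
qed

lemma subspace_AA_d: "subspace AA_d"
proof (rule subspaceI)
  show "0 \<in> AA_d"
    by (force simp: AA_d_def almost_automorphic_returns_along returns_along_def strict_mono_def)
  show "u + v \<in> AA_d" if "u \<in> AA_d" "v \<in> AA_d" for u v :: "'a linf"
    using that almost_automorphic_add by (auto simp: AA_d_def plus_bcontfun.rep_eq[abs_def])
  show "c *\<^sub>R u \<in> AA_d" if "u \<in> AA_d" for c and u :: "'a linf"
    using that almost_automorphic_compose[of u "\<lambda>x. c *\<^sub>R x"]
    by (auto simp: AA_d_def scaleR_bcontfun.rep_eq[abs_def] continuous_on_scaleR)
qed

lemma closed_AA_d: "closed (AA_d :: 'a::banach linf set)"
  unfolding closed_sequential_limits AA_d_def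
  by (auto intro: almost_automorphic_uniform_limit[OF tendsto_bcontfun_uniform_limit])

section \<open>Weighted ergodic sequences\<close>

definition weighted_mean :: "(int \<Rightarrow> real) \<Rightarrow> nat \<Rightarrow> (int \<Rightarrow> real) \<Rightarrow> real" where
  "weighted_mean p N x = 1 / (\<Sum>n=-int N..int N. p n) * (\<Sum>n=-int N..int N. x n * p n)"

lemma E_d_weighted_mean:
  "u \<in> E_d p \<longleftrightarrow> (\<lambda>N. weighted_mean p N (\<lambda>n. norm (apply_bcontfun u n))) \<longlonglongrightarrow> 0"
  by (simp add: E_d_def weighted_mean_def)

lemma weighted_mean_add:
  "weighted_mean p N (\<lambda>n. x n + y n) = weighted_mean p N x + weighted_mean p N y"
  by (simp add: weighted_mean_def distrib_right sum.distrib distrib_left)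

lemma weighted_mean_cmult: "weighted_mean p N (\<lambda>n. c * x n) = c * weighted_mean p N x"
  by (simp add: weighted_mean_def mult.assoc flip: sum_distrib_left)

context
  fixes p :: "int \<Rightarrow> real"
  assumes p: "\<And>n. 0 \<le> p n"
begin

lemma weighted_mean_mono:
  assumes "\<And>n. x n \<le> y n"
  shows "weighted_mean p N x \<le> weighted_mean p N y"
  unfolding weighted_mean_def
  by (intro mult_left_mono sum_mono mult_right_mono assms) (auto intro!: p sum_nonneg)

lemma weighted_mean_nonneg: "(\<And>n. 0 \<le> x n) \<Longrightarrow> 0 \<le> weighted_mean p N x"
  using weighted_mean_mono[of "\<lambda>_. 0" x N] by (simp add: weighted_mean_def)

text \<open>The inequality may be strict: the mean is \<open>0\<close> while no weight has been met.\<close>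

lemma weighted_mean_const: "0 \<le> c \<Longrightarrow> weighted_mean p N (\<lambda>_. c) \<le> c"
  by (cases "(\<Sum>n=-int N..int N. p n) = 0") (simp_all add: weighted_mean_def flip: sum_distrib_left)

lemma E_d_dominated:
  assumes w: "w \<in> E_d p" and u: "\<And>n. norm (apply_bcontfun u n) \<le> norm (apply_bcontfun w n)"
  shows "u \<in> E_d p"
  unfolding E_d_weighted_mean
  by (rule tendsto_sandwich[OF _ _ tendsto_const w[unfolded E_d_weighted_mean]])
     (auto intro!: always_eventually weighted_mean_nonneg weighted_mean_mono u)

lemma subspace_E_d: "subspace (E_d p)"
proof (rule subspaceI)
  show "0 \<in> E_d p"
    by (simp add: E_d_def)
  show "u + v \<in> E_d p" if "u \<in> E_d p" "v \<in> E_d p" for u v :: "'a linf"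
    unfolding E_d_weighted_mean
  proof (rule tendsto_sandwich[OF _ _ tendsto_const])
    show "(\<lambda>N. weighted_mean p N (\<lambda>n. norm (u n)) + weighted_mean p N (\<lambda>n. norm (v n))) \<longlonglongrightarrow> 0"
      using tendsto_add[OF that[unfolded E_d_weighted_mean]] by simp
  qed (auto intro!: always_eventually weighted_mean_nonneg weighted_mean_mono norm_triangle_ineq
         simp flip: weighted_mean_add)
  show "c *\<^sub>R u \<in> E_d p" if "u \<in> E_d p" for c and u :: "'a linf"
    using tendsto_mult_left[OF that[unfolded E_d_weighted_mean], of "\<bar>c\<bar>"]
    by (simp add: E_d_weighted_mean weighted_mean_cmult)
qed

text \<open>Replacing \<open>u\<close> by \<open>w m\<close> changes each mean by at most
  \<open>norm (u - w m)\<close>, uniformly in \<open>N\<close>.\<close>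

lemma closed_E_d: "closed (E_d p)"
  unfolding closed_sequential_limits
proof (intro allI impI)
  fix w and u :: "'a linf"
  assume w: "(\<forall>m. w m \<in> E_d p) \<and> w \<longlonglongrightarrow> u"
  show "u \<in> E_d p"
    unfolding E_d_weighted_mean
  proof (rule order_tendstoI)
    fix e :: real assume "0 < e"
    then obtain m where m: "norm (u - w m) < e / 2"
      using w LIMSEQ_D[of w u "e / 2"] by (metis half_gt_zero norm_minus_commute order_refl)
    have "(\<lambda>N. weighted_mean p N (\<lambda>n. norm (w m n))) \<longlonglongrightarrow> 0"
      using w by (simp flip: E_d_weighted_mean)
    then have "\<forall>\<^sub>F N in sequentially. weighted_mean p N (\<lambda>n. norm (w m n)) < e / 2"
      by (rule order_tendstoD) (use \<open>0 < e\<close> in simp)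
    then show "\<forall>\<^sub>F N in sequentially. weighted_mean p N (\<lambda>n. norm (u n)) < e"
    proof eventually_elim
      case (elim N)
      have "norm (u n) \<le> norm (w m n) + norm (u - w m)" for n
        using norm_triangle_sub[of "u n" "w m n"] norm_bounded[of "u - w m" n] by simp
      then have "weighted_mean p N (\<lambda>n. norm (u n))
          \<le> weighted_mean p N (\<lambda>n. norm (w m n)) + weighted_mean p N (\<lambda>_. norm (u - w m))"
        by (simp add: weighted_mean_mono flip: weighted_mean_add)
      also have "weighted_mean p N (\<lambda>_. norm (u - w m)) \<le> norm (u - w m)"
        by (simp add: weighted_mean_const)
      finally show ?case using elim m by simp
    qed
  \<comment> \<open>The other half of \<open>order_tendstoI\<close>: the means are nonnegative, so
    they exceed every negative bound.\<close>
  qed (auto intro!: always_eventually elim!: order.strict_trans2 intro: weighted_mean_nonneg)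
qed

end

section \<open>Radial truncation\<close>

text \<open>For \<open>0 \<le> c\<close> this is the radial retraction onto the closed ball of
  radius \<open>c\<close>. With \<open>max\<close> in place of a case split, continuity for
  \<open>c > 0\<close> follows by composition.\<close>

definition truncate :: "real \<Rightarrow> 'a::real_normed_vector \<Rightarrow> 'a" where
  "truncate c x = (c / max c (norm x)) *\<^sub>R x"

text \<open>For \<open>c = 0\<close> the factor is \<open>0\<close>, also at \<open>x = 0\<close> where it reads \<open>0 / 0\<close>.\<close>

lemma continuous_on_truncate:
  assumes "0 \<le> c"
  shows "continuous_on S (truncate c)"
proof (cases "c = 0")
  case False
  then have "max c (norm x) \<noteq> 0" for x :: 'a
    using assms by (auto simp: max_def)
  then show ?thesis
    unfolding truncate_def[abs_def] by (intro continuous_intros) auto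
qed (simp add: truncate_def[abs_def])

lemma norm_truncate_le:
  assumes "0 \<le> c"
  shows "norm (truncate c x) \<le> c"
proof (cases "norm x \<le> c")
  case True
  then show ?thesis
    using assms by (cases "c = 0") (auto simp: truncate_def max_def)
next
  case False
  then show ?thesis
    using assms by (auto simp: truncate_def max_def)
qed

text \<open>Truncation only shortens \<open>x\<close> along its own ray, so the error is the excess
  of the norm over \<open>c\<close>; this is what the ergodic part must dominate.\<close>

lemma norm_diff_truncate:
  assumes "0 \<le> c"
  shows "norm (x - truncate c x) = max 0 (norm x - c)"
proof (cases "norm x \<le> c")
  case True
  then show ?thesis
    using assms by (cases "c = 0") (auto simp: truncate_def max_def)
next
  case False
  then have x: "norm x > 0"
    using assms by linarith
  have "x - truncate c x = (1 - c / norm x) *\<^sub>R x"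
    using False by (simp add: truncate_def max_def scaleR_diff_left)
  also have "norm \<dots> = (1 - c / norm x) * norm x"
    using False x assms by (simp add: field_simps)
  finally show ?thesis
    using False x by (simp add: field_simps max_def)
qed

text \<open>Supplies the hypothesis \<open>dec\<close> of \<open>closed_sum_subspaces\<close>, with
  the norm of \<open>v + w\<close> as truncation radius.\<close>

lemma truncate_decomposition:
  fixes v w :: "'a::banach linf"
  assumes p: "\<And>n. 0 \<le> p n" and v: "v \<in> AA_d" and w: "w \<in> E_d p"
  shows "\<exists>v'\<in>AA_d. v + w - v' \<in> E_d p \<and> norm v' \<le> norm (v + w)"
proof -
  define c where "c = norm (v + w)"
  have c: "0 \<le> c"
    by (simp add: c_def)
  have "bounded (range (\<lambda>n. truncate c (v n)))"
    using norm_truncate_le[OF c] by (auto intro!: boundedI)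
  then obtain v' :: "'a linf" where v': "apply_bcontfun v' = (\<lambda>n. truncate c (v n))"
    using bounded_sequence_in_linf[THEN iffD2] by blast
  have "v' \<in> AA_d"
    using v almost_automorphic_compose[OF _ continuous_on_truncate[OF c]] by (simp add: AA_d_def v')
  moreover have "norm v' \<le> c"
    by (rule norm_bound) (simp add: v' norm_truncate_le[OF c])
  moreover have "v + w - v' \<in> E_d p"
  proof -
    have "norm (v n) \<le> c + norm (w n)" for n
      using norm_bounded[of "v + w" n] norm_triangle_ineq4[of "v n + w n" "w n"] by (simp add: c_def)
    then have "norm ((v - v') n) \<le> norm (w n)" for n
      by (simp add: v' norm_diff_truncate[OF c] algebra_simps)
    then have "v - v' \<in> E_d p"
      by (rule E_d_dominated[OF p w])
    then have "(v - v') + w \<in> E_d p"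
      by (rule subspace_add[OF subspace_E_d[OF p] _ w])
    then show ?thesis
      by (simp add: algebra_simps)
  qed
  ultimately show ?thesis
    by (auto simp: c_def)
qed

theorem theorem8p9:
  fixes p :: "int \<Rightarrow> real"
  assumes "p \<in> M_d"
  shows "subspace (PAA_d p :: 'a::banach linf set) \<and> complete (PAA_d p :: 'a linf set)"
proof -
  have p: "\<And>n. 0 \<le> p n"
    using assms by (simp add: M_d_def)
  have PAA: "(PAA_d p :: 'a linf set) = {v + w |v w. v \<in> AA_d \<and> w \<in> E_d p}"
    by (auto simp: PAA_d_def)
  have "subspace (PAA_d p :: 'a linf set)"
    unfolding PAA by (rule subspace_sums[OF subspace_AA_d subspace_E_d[OF p]])
  moreover have "closed (PAA_d p :: 'a linf set)"
    unfolding PAA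
    by (intro closed_sum_subspaces subspace_AA_d closed_AA_d subspace_E_d closed_E_d
          truncate_decomposition p)
  \<comment> \<open>In the Banach space \<open>'a linf\<close> the closed sets are exactly the
    complete ones.\<close>
  ultimately show ?thesis
    by (simp add: complete_eq_closed)
qed

end
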